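(* A tree $T$ is perfect for the star-game with Minimizer responding (and Maximizer initiating) if and only if $T$ belongs to the family $\mathcal{E}$.
   Context: Graphs are finite, simple and undirected; a tree has at least one vertex. $P_3$ is the path on three vertices; copies of $P_3$ in a graph are subgraphs, not necessarily induced. The star-game on a graph $G$ is played by two players, Maximizer and Minimizer; throughout the game one of them is the initiator and the other is the responder. In each round, the initiator chooses a vertex $v$ of the current graph such that the current graph contains at least one copy of $P_3$ with $v$ as its center vertex (degree-2 vertex of the path); the responder then chooses one copy of $P_3$ in the current graph with $v$ as its center; the three vertices of that copy are removed, and the next round is played on the subgraph induced by the remaining vertices. The game ends when the remaining graph contains no copy of $P_3$. Maximizer tries to maximize, and Minimizer tries to minimize, the number of copies of $P_3$ taken. The value of the game is the number of copies taken under optimal play by both players. A graph is perfect (for a given version of the game) if under optimal play all vertices are taken, i.e. the value of the game equals $|V(G)|/3$. $\mathcal{E}$ is the family of forests obtained as follows: start with some number of disjoint copies of $P_3$; then repeatedly (any finite number of times, possibly zero) add a new disjoint copy of $P_3$ and add at most one edge between it and each existing component of the forest built so far, where no added edge is incident with the central vertex of the new $P_3$ (so each added edge joins an end-vertex of the new $P_3$ to an arbitrary vertex of an existing component). *)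

theory Defs
  imports Complex_Main
begin

datatype 'a graph = Graph (verts: "'a set") (edges: "'a set set")

definition simple_graph :: "'a graph \<Rightarrow> bool" where
  "simple_graph G \<longleftrightarrow> finite (verts G) \<and> (\<forall>e\<in>edges G. e \<subseteq> verts G \<and> card e = 2)"

definition adj :: "'a graph \<Rightarrow> 'a \<Rightarrow> 'a \<Rightarrow> bool" where
  "adj G u w \<longleftrightarrow> {u, w} \<in> edges G"

definition connected_graph :: "'a graph \<Rightarrow> bool" where
  "connected_graph G \<longleftrightarrow> (\<forall>u\<in>verts G. \<forall>w\<in>verts G. (adj G)\<^sup>*\<^sup>* u w)"

definition is_cycle :: "'a graph \<Rightarrow> 'a list \<Rightarrow> bool" where
  "is_cycle G vs \<longleftrightarrow> 3 \<le> length vs \<and> distinct vs \<and>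
     (\<forall>i. Suc i < length vs \<longrightarrow> adj G (vs ! i) (vs ! Suc i)) \<and> adj G (last vs) (hd vs)"

definition tree :: "'a graph \<Rightarrow> bool" where
  "tree G \<longleftrightarrow> simple_graph G \<and> verts G \<noteq> {} \<and> connected_graph G \<and> (\<nexists>vs. is_cycle G vs)"

definition components :: "'a graph \<Rightarrow> 'a set set" where
  "components G = {{w \<in> verts G. (adj G)\<^sup>*\<^sup>* u w} | u. u \<in> verts G}"

definition induced :: "'a graph \<Rightarrow> 'a set \<Rightarrow> 'a graph" where
  "induced G S = Graph (verts G \<inter> S) {e \<in> edges G. e \<subseteq> S}"

definition subgraph :: "'a graph \<Rightarrow> 'a graph \<Rightarrow> bool" where
  "subgraph H G \<longleftrightarrow> verts H \<subseteq> verts G \<and> edges H \<subseteq> edges G"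

definition P3 :: "'a \<Rightarrow> 'a \<Rightarrow> 'a \<Rightarrow> 'a graph" where
  "P3 a v b = Graph {a, v, b} {{a, v}, {v, b}}"

definition is_P3 :: "'a graph \<Rightarrow> bool" where
  "is_P3 H \<longleftrightarrow> (\<exists>a v b. distinct [a, v, b] \<and> H = P3 a v b)"

definition P3_copies :: "'a graph \<Rightarrow> 'a \<Rightarrow> 'a graph set" where
  "P3_copies G v = {P3 a v b | a b. distinct [a, v, b] \<and> subgraph (P3 a v b) G}"

definition centers :: "'a graph \<Rightarrow> 'a set" where
  "centers G = {v. P3_copies G v \<noteq> {}}"

lemma P3_copies_verts:
  assumes "H \<in> P3_copies G v"
  shows "verts H \<subseteq> verts G" "verts H \<noteq> {}"
  using assms by (auto simp: P3_copies_def P3_def subgraph_def)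

lemma centers_subset: "centers G \<subseteq> verts G"
  by (auto simp: centers_def P3_copies_def P3_def subgraph_def)

lemma finite_P3_copies:
  assumes "finite (verts G)"
  shows "finite (P3_copies G v)"
proof -
  have "P3_copies G v \<subseteq> (\<lambda>(a, b). P3 a v b) ` (verts G \<times> verts G)"
    by (auto simp: P3_copies_def P3_def subgraph_def)
  then show ?thesis
    using assms by (meson finite_SigmaI finite_imageI finite_subset)
qed

datatype player = Maximizer | Minimizer

fun opponent :: "player \<Rightarrow> player" where
  "opponent Maximizer = Minimizer"
| "opponent Minimizer = Maximizer"

fun best :: "player \<Rightarrow> nat set \<Rightarrow> nat" where
  "best Maximizer A = Max A"
| "best Minimizer A = Min A"

text \<open>The value by backward induction, with responder \<open>r\<close>. Both sets of options are finite and
  nonempty wherever \<open>best\<close> is applied; the finiteness test only makes the recursion terminate on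
  arguments that are not finite graphs.\<close>

function star_value :: "player \<Rightarrow> 'a graph \<Rightarrow> nat" where
  "star_value r G =
     (if finite (verts G) \<and> centers G \<noteq> {}
      then best (opponent r)
             ((\<lambda>v. best r ((\<lambda>H. Suc (star_value r (induced G (verts G - verts H)))) ` P3_copies G v))
              ` centers G)
      else 0)"
  by pat_completeness auto
termination
proof (relation "measure (\<lambda>(r, G). card (verts G))")
  fix r :: player and G :: "'a graph" and v H
  assume "finite (verts G) \<and> centers G \<noteq> {}" and H: "H \<in> P3_copies G v"
  then have "verts G \<inter> (verts G - verts H) \<subset> verts G"
    using P3_copies_verts[OF H] by blast
  then show "((r, induced G (verts G - verts H)), r, G) \<in> measure (\<lambda>(r, G). card (verts G))"
    using \<open>finite (verts G) \<and> centers G \<noteq> {}\<close> by (simp add: induced_def psubset_card_mono)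
qed simp

declare star_value.simps [simp del]

definition perfect :: "player \<Rightarrow> 'a graph \<Rightarrow> bool" where
  "perfect r G \<longleftrightarrow> real (star_value r G) = real (card (verts G)) / 3"

inductive_set family_E :: "'a graph set" where
  start: "Graph (\<Union>(verts ` \<H>)) (\<Union>(edges ` \<H>)) \<in> family_E"
  if "finite \<H>" and "\<forall>H\<in>\<H>. is_P3 H" and "pairwise (\<lambda>H K. disjnt (verts H) (verts K)) \<H>"
| extend: "Graph (verts G \<union> {a, v, b}) (edges G \<union> {{a, v}, {v, b}} \<union> F) \<in> family_E"
  if "G \<in> family_E" and "distinct [a, v, b]" and "disjnt {a, v, b} (verts G)"
    and "F \<subseteq> {{x, y} | x y. x \<in> {a, b} \<and> y \<in> verts G}"
    and "\<forall>C\<in>components G. card {e \<in> F. e \<inter> C \<noteq> {}} \<le> 1"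

end

theory Submission
  imports Defs
begin

text \<open>
  The argument works for all forests. Each copy of \<open>P\<^sub>3\<close> uses up three vertices, so perfection
  means exactly that no vertex is ever lost; hence a graph that has a center is perfect iff
  Maximizer can name a center all of whose copies leave a perfect graph behind
  (\<open>perfect_iff_center\<close>).

  A member of \<open>family_E\<close> is perfect because Maximizer can undo its construction: the center of the
  copy added last has degree 2, so Minimizer has no choice but to remove that copy
  (\<open>family_E_perfect\<close>).

  Conversely, let \<open>v\<close> be such a center in a perfect forest. If \<open>v\<close> has degree 2, the unique copy
  around \<open>v\<close> can be regarded as the last one added: the rest is perfect, so by induction it belongs
  to the family, and a second edge from the copy into the same component would close a cycle
  (\<open>family_E_attach\<close>). The degree of \<open>v\<close> cannot be larger, by counting modulo 3
  (\<open>card_branches\<close>). For in a member of the family every union of components has a number of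
  vertices divisible by 3. Among three neighbours \<open>a\<close>, \<open>b\<close>, \<open>c\<close> of \<open>v\<close>, Minimizer may take any two
  and so leave the branch at the third one intact; thus each of the three branches at \<open>v\<close> has size
  divisible by 3, and so has the set of all vertices outside these branches other than \<open>v\<close>,
  again a union of components of what is left. Then the number of vertices is 1 modulo 3, which is impossible in a perfect graph.
\<close>

section \<open>Perfection as a condition on Maximizer's first move\<close>

abbreviation remove :: "'a graph \<Rightarrow> 'a graph \<Rightarrow> 'a graph" where
  "remove G H \<equiv> induced G (verts G - verts H)"

lemma verts_remove: "verts (remove G H) = verts G - verts H"
  by (auto simp: induced_def)

lemma P3_copies_iff:
  "H \<in> P3_copies G v \<longleftrightarrow> (\<exists>a b. H = P3 a v b \<and> distinct [a, v, b] \<and> {a, v, b} \<subseteq> verts G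
     \<and> adj G v a \<and> adj G v b)"
  unfolding P3_copies_def P3_def subgraph_def adj_def by (auto simp: insert_commute)

lemma card_remove_P3:
  assumes "finite (verts G)" "H \<in> P3_copies G v"
  shows "card (verts G) = card (verts (remove G H)) + 3"
proof -
  obtain a b where ab: "H = P3 a v b" "distinct [a, v, b]"
    using assms(2) unfolding P3_copies_iff by blast
  have card_H: "card (verts H) = 3"
    using ab by (simp add: P3_def)
  have sub: "verts H \<subseteq> verts G"
    using P3_copies_verts(1)[OF assms(2)] .
  have "card (verts (remove G H)) = card (verts G) - 3"
    using card_H sub assms(1) by (simp add: verts_remove card_Diff_subset finite_subset)
  moreover have "3 \<le> card (verts G)"
    using card_mono[OF assms(1) sub] card_H by simp
  ultimately show ?thesis by simp
qed

lemma star_value_no_center: "centers G = {} \<Longrightarrow> star_value r G = 0"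
  by (subst star_value.simps) simp

lemma star_value_Minimizer:
  assumes "finite (verts G)" "centers G \<noteq> {}"
  shows "star_value Minimizer G =
    Max ((\<lambda>v. Min ((\<lambda>H. Suc (star_value Minimizer (remove G H))) ` P3_copies G v)) ` centers G)"
  using assms by (subst star_value.simps) simp

lemma star_value_le_card:
  assumes "finite (verts G)"
  shows "3 * star_value Minimizer G \<le> card (verts G)"
  using assms
proof (induction "card (verts G)" arbitrary: G rule: less_induct)
  case less
  show ?case
  proof (cases "centers G = {}")
    case True
    then show ?thesis by (simp add: star_value_no_center)
  next
    case False
    let ?m = "\<lambda>v. Min ((\<lambda>H. Suc (star_value Minimizer (remove G H))) ` P3_copies G v)"
    have fin: "finite (centers G)"
      using less.prems centers_subset finite_subset by metis
    have "?m v \<le> card (verts G) div 3" if v: "v \<in> centers G" for v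
    proof -
      obtain H where H: "H \<in> P3_copies G v"
        using v by (auto simp: centers_def)
      have card: "card (verts G) = card (verts (remove G H)) + 3"
        using card_remove_P3[OF less.prems H] .
      have "3 * star_value Minimizer (remove G H) \<le> card (verts (remove G H))"
        using card less.prems by (intro less.hyps) (auto simp: verts_remove)
      moreover have "?m v \<le> Suc (star_value Minimizer (remove G H))"
        using H finite_P3_copies[OF less.prems] by (intro Min_le) auto
      ultimately show ?thesis using card by linarith
    qed
    then have "star_value Minimizer G \<le> card (verts G) div 3"
      unfolding star_value_Minimizer[OF less.prems False] using fin False by (subst Max_le_iff) auto
    then show ?thesis by linarith
  qed
qed

lemma perfect_iff: "perfect r G \<longleftrightarrow> 3 * star_value r G = card (verts G)"
  unfolding perfect_def by linarith

text \<open>The value never exceeds a third of the number of vertices, so a value that loses nothing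
  must be attained along every reply of Minimizer, not only along the best one.\<close>

lemma perfect_iff_center:
  assumes fin: "finite (verts G)" and "centers G \<noteq> {}"
  shows "perfect Minimizer G \<longleftrightarrow>
    (\<exists>v\<in>centers G. \<forall>H\<in>P3_copies G v. perfect Minimizer (remove G H))"
proof -
  let ?s = "\<lambda>H. Suc (star_value Minimizer (remove G H))"
  let ?m = "\<lambda>v. Min (?s ` P3_copies G v)"
  have finc: "finite (centers G)"
    using fin centers_subset finite_subset by metis
  have finP: "finite (?s ` P3_copies G v)" for v
    using finite_P3_copies[OF fin] by simp
  have val: "star_value Minimizer G = Max (?m ` centers G)"
    using star_value_Minimizer[OF assms] .
  (* With the bound isolated on one side, it can be moved through Max and Min. *)
  have third: "(m + 2) div 3 \<le> k \<longleftrightarrow> m \<le> 3 * k" for m k :: nat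
    by presburger
  have perfect_remove: "perfect Minimizer (remove G H) \<longleftrightarrow> card (verts G) \<le> 3 * ?s H"
    if "H \<in> P3_copies G v" for H v
    using card_remove_P3[OF fin that] star_value_le_card[of "remove G H"] fin
    by (auto simp: perfect_iff verts_remove)
  have "perfect Minimizer G \<longleftrightarrow> card (verts G) \<le> 3 * Max (?m ` centers G)"
    using star_value_le_card[OF fin] unfolding perfect_iff val by linarith
  also have "\<dots> \<longleftrightarrow> (card (verts G) + 2) div 3 \<le> Max (?m ` centers G)"
    by (simp only: third)
  also have "\<dots> \<longleftrightarrow> (\<exists>v\<in>centers G. (card (verts G) + 2) div 3 \<le> ?m v)"
    using finc assms(2) by (subst Max_ge_iff) auto
  also have "\<dots> \<longleftrightarrow> (\<exists>v\<in>centers G. \<forall>H\<in>P3_copies G v. (card (verts G) + 2) div 3 \<le> ?s H)"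
  proof (rule bex_cong[OF refl])
    fix v assume "v \<in> centers G"
    then have "?s ` P3_copies G v \<noteq> {}"
      by (auto simp: centers_def)
    then show "(card (verts G) + 2) div 3 \<le> ?m v
        \<longleftrightarrow> (\<forall>H\<in>P3_copies G v. (card (verts G) + 2) div 3 \<le> ?s H)"
      using finP[of v] by (subst Min_ge_iff) auto
  qed
  also have "\<dots> \<longleftrightarrow> (\<exists>v\<in>centers G. \<forall>H\<in>P3_copies G v. card (verts G) \<le> 3 * ?s H)"
    by (simp only: third)
  also have "\<dots> \<longleftrightarrow> (\<exists>v\<in>centers G. \<forall>H\<in>P3_copies G v. perfect Minimizer (remove G H))"
    using perfect_remove by (intro bex_cong ball_cong refl) blast
  finally show ?thesis .
qed

section \<open>Members of the family are perfect\<close>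

definition attach_P3 :: "'a graph \<Rightarrow> 'a \<Rightarrow> 'a \<Rightarrow> 'a \<Rightarrow> 'a set set \<Rightarrow> 'a graph" where
  "attach_P3 G a v b F = Graph (verts G \<union> {a, v, b}) (edges G \<union> {{a, v}, {v, b}} \<union> F)"

lemma simple_attach_P3:
  assumes "simple_graph G" "distinct [a, v, b]" "disjnt {a, v, b} (verts G)"
    and "F \<subseteq> {{x, y} | x y. x \<in> {a, b} \<and> y \<in> verts G}"
  shows "simple_graph (attach_P3 G a v b F)"
proof -
  have "e \<subseteq> verts G \<union> {a, v, b} \<and> card e = 2" if e: "e \<in> F" for e
  proof -
    obtain x y where "e = {x, y}" "x \<in> {a, b}" "y \<in> verts G"
      using e assms(4) by blast
    moreover have "x \<noteq> y"
      using calculation assms(3) by (auto simp: disjnt_def)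
    ultimately show ?thesis by auto
  qed
  then show ?thesis
    using assms by (auto simp: simple_graph_def attach_P3_def)
qed

text \<open>Disjoint copies of \<open>P\<^sub>3\<close> arise from the empty graph by attaching copies without extra edges,
  so a single induction step covers both ways of building members of the family.\<close>

lemma family_E_attach_induct [consumes 1, case_names empty attach]:
  assumes "G \<in> family_E"
    and empty: "P (Graph {} {})"
    and attach: "\<And>G a v b F. simple_graph G \<Longrightarrow> P G \<Longrightarrow> distinct [a, v, b]
      \<Longrightarrow> disjnt {a, v, b} (verts G) \<Longrightarrow> F \<subseteq> {{x, y} | x y. x \<in> {a, b} \<and> y \<in> verts G}
      \<Longrightarrow> P (attach_P3 G a v b F)"
  shows "P G"
proof -
  have "simple_graph G \<and> P G"
    using assms(1)
  proof induction
    case (start \<H>)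
    then show ?case
    proof (induction \<H> rule: finite_induct)
      case empty
      then show ?case using assms(2) by (simp add: simple_graph_def)
    next
      case (insert H \<H>)
      let ?G = "Graph (\<Union>(verts ` \<H>)) (\<Union>(edges ` \<H>))"
      obtain a v b where H: "distinct [a, v, b]" "H = P3 a v b"
        using insert.prems by (auto simp: is_P3_def)
      have G: "simple_graph ?G" "P ?G"
        using insert by (auto simp: pairwise_insert)
      have "disjnt (verts H) (verts K)" if "K \<in> \<H>" for K
        using insert.prems(2) insert.hyps(2) that by (auto simp: pairwise_insert)
      then have "disjnt {a, v, b} (verts ?G)"
        using H by (auto simp: P3_def disjnt_def)
      then have "simple_graph (attach_P3 ?G a v b {}) \<and> P (attach_P3 ?G a v b {})"
        using attach[of ?G a v b "{}"] simple_attach_P3[of ?G a v b "{}"] G H by simp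
      moreover have "attach_P3 ?G a v b {}
          = Graph (\<Union>(verts ` insert H \<H>)) (\<Union>(edges ` insert H \<H>))"
        using H by (auto simp: attach_P3_def P3_def)
      ultimately show ?case by simp
    qed
  next
    case (extend G a v b F)
    then show ?case
      using attach[of G a v b F] simple_attach_P3[of G a v b F] by (simp add: attach_P3_def)
  qed
  then show ?thesis by blast
qed

text \<open>The center of an attached copy has no neighbours besides the two ends, so its copy is unique
  and removing it undoes the attachment.\<close>

lemma perfect_attach_P3:
  assumes "simple_graph G" "perfect Minimizer G"
    and "distinct [a, v, b]" "disjnt {a, v, b} (verts G)"
    and F: "F \<subseteq> {{x, y} | x y. x \<in> {a, b} \<and> y \<in> verts G}"
  shows "perfect Minimizer (attach_P3 G a v b F)"
proof -
  let ?G = "attach_P3 G a v b F"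
  have fin: "finite (verts ?G)"
    using assms(1) by (simp add: simple_graph_def attach_P3_def)
  have old: "e \<subseteq> verts G" if "e \<in> edges G" for e
    using that assms(1) by (auto simp: simple_graph_def)
  have new: "v \<notin> e \<and> e \<inter> {a, b} \<noteq> {}" if "e \<in> F" for e
    using that F assms(3,4) by (auto simp: disjnt_def)
  have nbrs: "adj ?G v x \<longleftrightarrow> x = a \<or> x = b" for x
    using old[of "{v, x}"] new[of "{v, x}"] assms(3,4)
    by (auto simp: adj_def attach_P3_def doubleton_eq_iff disjnt_def)
  have inG: "{a, v, b} \<subseteq> verts ?G"
    by (auto simp: attach_P3_def)
  have P3_sym: "P3 b v a = P3 a v b"
    by (auto simp: P3_def insert_commute)
  have copies: "P3_copies ?G v = {P3 a v b}"
  proof (intro equalityI subsetI)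
    fix H assume "H \<in> P3_copies ?G v"
    then show "H \<in> {P3 a v b}"
      using nbrs P3_sym unfolding P3_copies_iff by auto
  next
    fix H assume "H \<in> {P3 a v b}"
    then show "H \<in> P3_copies ?G v"
      using nbrs inG assms(3) unfolding P3_copies_iff by blast
  qed
  have verts: "verts (remove ?G (P3 a v b)) = verts G"
    using assms(4) unfolding verts_remove by (auto simp: attach_P3_def P3_def disjnt_def)
  have edges: "edges (remove ?G (P3 a v b)) = edges G"
    using old new assms(4) by (fastforce simp: induced_def attach_P3_def P3_def disjnt_def)
  have "remove ?G (P3 a v b) = G"
    using verts edges by (simp add: graph.expand)
  moreover have "v \<in> centers ?G"
    using copies by (simp add: centers_def)
  ultimately show ?thesis
    using assms(2) copies perfect_iff_center[OF fin] by force
qed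

lemma family_E_perfect:
  fixes G :: "'a graph"
  assumes "G \<in> family_E"
  shows "perfect Minimizer G"
  using assms
proof (induction rule: family_E_attach_induct)
  case empty
  have "centers (Graph {} {} :: 'a graph) = {}"
    using centers_subset[of "Graph {} {} :: 'a graph"] by simp
  then show ?case by (simp add: perfect_iff star_value_no_center)
next
  case (attach G a v b F)
  then show ?case
    using perfect_attach_P3[of G a v b F] by simp
qed

section \<open>Forests\<close>

lemma rtranclp_distinct_path:
  assumes "R\<^sup>*\<^sup>* p q"
  shows "\<exists>vs. vs \<noteq> [] \<and> hd vs = p \<and> last vs = q \<and> distinct vs
    \<and> (\<forall>i. Suc i < length vs \<longrightarrow> R (vs ! i) (vs ! Suc i))"
  using assms
proof (induction rule: rtranclp_induct)
  case base
  then show ?case by (intro exI[of _ "[p]"]) auto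
next
  case (step y z)
  then obtain vs where vs: "vs \<noteq> []" "hd vs = p" "last vs = y" "distinct vs"
    "\<And>i. Suc i < length vs \<Longrightarrow> R (vs ! i) (vs ! Suc i)"
    by blast
  show ?case
  proof (cases "z \<in> set vs")
    case True
    then obtain k where k: "k < length vs" "vs ! k = z"
      by (auto simp: in_set_conv_nth)
    (* The walk returns to an earlier vertex: cut off the loop. *)
    have "last (take (Suc k) vs) = z"
      using k by (simp add: take_Suc_conv_app_nth)
    then show ?thesis
      using vs by (intro exI[of _ "take (Suc k) vs"]) auto
  next
    case False
    have "R ((vs @ [z]) ! i) ((vs @ [z]) ! Suc i)" if "Suc i < length (vs @ [z])" for i
    proof (cases "Suc i < length vs")
      case True
      then show ?thesis using vs(5) by (simp add: nth_append)
    next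
      case False
      then have "Suc i = length vs" using that by simp
      then show ?thesis
        using vs(1,3) step.hyps(2) by (simp add: nth_append last_conv_nth flip: \<open>Suc i = length vs\<close>)
    qed
    then show ?thesis
      using vs False by (intro exI[of _ "vs @ [z]"]) auto
  qed
qed

text \<open>Every edge of a forest is a bridge: another connection between its ends contains a path,
  which the edge would close to a cycle.\<close>

lemma forest_edge_bridge:
  assumes "\<nexists>vs. is_cycle G vs" "adj G p q" "p \<noteq> q"
  shows "\<not> (\<lambda>x y. adj G x y \<and> {x, y} \<noteq> {p, q})\<^sup>*\<^sup>* p q"
proof
  assume "(\<lambda>x y. adj G x y \<and> {x, y} \<noteq> {p, q})\<^sup>*\<^sup>* p q"
  from rtranclp_distinct_path[OF this] obtain vs where
    vs: "vs \<noteq> []" "hd vs = p" "last vs = q" "distinct vs"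
    and step: "\<And>i. Suc i < length vs \<Longrightarrow> adj G (vs ! i) (vs ! Suc i) \<and> {vs ! i, vs ! Suc i} \<noteq> {p, q}"
    by blast
  have "length vs \<noteq> 0" "length vs \<noteq> 1"
    using vs assms(3) by (auto simp: length_Suc_conv)
  moreover have "length vs \<noteq> 2"
  proof
    assume "length vs = 2"
    then show False
      using step[of 0] vs by (auto simp: hd_conv_nth last_conv_nth)
  qed
  ultimately have "3 \<le> length vs" by linarith
  moreover have "adj G (last vs) (hd vs)"
    using assms(2) vs by (simp add: adj_def insert_commute)
  ultimately have "is_cycle G vs"
    using vs(4) step by (simp add: is_cycle_def)
  then show False using assms(1) by blast
qed

lemma simple_induced: "simple_graph G \<Longrightarrow> simple_graph (induced G S)"
  by (auto simp: simple_graph_def induced_def)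

lemma adj_induced: "adj (induced G S) x y \<longleftrightarrow> adj G x y \<and> x \<in> S \<and> y \<in> S"
  by (auto simp: adj_def induced_def)

lemma forest_induced:
  assumes "\<nexists>vs. is_cycle G vs"
  shows "\<nexists>vs. is_cycle (induced G S) vs"
  using assms unfolding is_cycle_def adj_induced by blast

lemma adj_commute: "adj G x y \<longleftrightarrow> adj G y x"
  by (simp add: adj_def insert_commute)

lemma simple_adj:
  assumes "simple_graph G" "adj G x y"
  shows "x \<in> verts G" "y \<in> verts G" "x \<noteq> y"
proof -
  have "{x, y} \<subseteq> verts G" "card {x, y} = 2"
    using assms by (auto simp: simple_graph_def adj_def)
  then show "x \<in> verts G" "y \<in> verts G" "x \<noteq> y" by auto
qed

section \<open>The copy around a center of degree 2 as the last one added\<close>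

text \<open>Two edges that lead from the copy into the same remaining component could be joined inside
  that component and inside the copy, so neither of them would be a bridge.\<close>

lemma family_E_attach:
  assumes "simple_graph G" and forest: "\<nexists>vs. is_cycle G vs"
    and dist: "distinct [a, v, b]" and adj: "adj G v a" "adj G v b"
    and deg: "\<And>c. adj G v c \<Longrightarrow> c = a \<or> c = b"
    and rest: "remove G (P3 a v b) \<in> family_E"
  shows "G \<in> family_E"
proof -
  let ?K = "remove G (P3 a v b)"
  define F where "F = {{x, y} | x y. x \<in> {a, b} \<and> y \<in> verts ?K \<and> adj G x y}"
  have inG: "{a, v, b} \<subseteq> verts G"
    using simple_adj[OF assms(1)] adj by blast
  have vK: "verts ?K = verts G - {a, v, b}"
    using verts_remove[of G "P3 a v b"] by (simp add: P3_def)
  have adjK: "adj ?K x y \<longleftrightarrow> adj G x y \<and> x \<in> verts ?K \<and> y \<in> verts ?K" for x y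
    unfolding adj_induced by (simp add: verts_remove)
  have va: "adj G a v" "adj G b v"
    using adj by (simp_all add: adj_commute)
  have no_ab: "\<not> adj G a b"
  proof
    assume "adj G a b"
    moreover have "(\<lambda>x y. adj G x y \<and> {x, y} \<noteq> {a, b})\<^sup>*\<^sup>* a b"
      using va adj dist by (intro converse_rtranclp_into_rtranclp[of _ a v] r_into_rtranclp)
        (auto simp: doubleton_eq_iff)
    ultimately show False
      using forest_edge_bridge[OF forest] dist by auto
  qed
  have F1: "card {e \<in> F. e \<inter> C \<noteq> {}} \<le> 1" if C: "C \<in> components ?K" for C
  proof -
    obtain u where C_def: "C = {w \<in> verts ?K. (adj ?K)\<^sup>*\<^sup>* u w}"
      using C by (auto simp: components_def)
    have "e = e'" if e: "e \<in> F" "e \<inter> C \<noteq> {}" and e': "e' \<in> F" "e' \<inter> C \<noteq> {}" for e e'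
    proof (rule ccontr)
      assume ne: "e \<noteq> e'"
      obtain x y where xy: "e = {x, y}" "x \<in> {a, b}" "y \<in> C" "adj G x y" "y \<in> verts ?K"
        using e vK unfolding F_def C_def by auto
      obtain x' y' where xy': "e' = {x', y'}" "x' \<in> {a, b}" "y' \<in> C" "adj G x' y'" "y' \<in> verts ?K"
        using e' vK unfolding F_def C_def by auto
      define R where "R = (\<lambda>s t. adj G s t \<and> {s, t} \<noteq> {x, y})"
      have "R x v" "R v x'"
        unfolding R_def using xy xy' va adj vK by (auto simp: doubleton_eq_iff)
      moreover have "R x' y'"
        unfolding R_def using xy xy' ne by auto
      ultimately have "R\<^sup>*\<^sup>* x y'"
        by (meson rtranclp.rtrancl_refl rtranclp.rtrancl_into_rtrancl)
      moreover have "R\<^sup>*\<^sup>* y' y"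
      proof -
        have "symp (adj ?K)"
          by (auto simp: symp_def adj_commute)
        then have "(adj ?K)\<^sup>*\<^sup>* y' u"
          using xy'(3) unfolding C_def by (auto dest: sympD[OF symp_rtranclp])
        then have "(adj ?K)\<^sup>*\<^sup>* y' y"
          using xy(3) unfolding C_def by auto
        moreover have "adj ?K s t \<Longrightarrow> R s t" for s t
          using xy(2) vK unfolding adjK R_def by (auto simp: doubleton_eq_iff)
        ultimately show ?thesis
          using mono_rtranclp[of "adj ?K" R] by blast
      qed
      ultimately have "R\<^sup>*\<^sup>* x y"
        by (rule rtranclp_trans)
      then show False
        unfolding R_def using forest_edge_bridge[OF forest xy(4)] simple_adj(3)[OF assms(1) xy(4)] by blast
    qed
    moreover have "finite {e \<in> F. e \<inter> C \<noteq> {}}"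
    proof (rule finite_subset)
      show "{e \<in> F. e \<inter> C \<noteq> {}} \<subseteq> Pow (verts G)"
        using inG vK unfolding F_def by auto
      show "finite (Pow (verts G))"
        using assms(1) by (simp add: simple_graph_def)
    qed
    ultimately show ?thesis
      by (auto simp: card_le_Suc0_iff_eq)
  qed
  have "Graph (verts ?K \<union> {a, v, b}) (edges ?K \<union> {{a, v}, {v, b}} \<union> F) \<in> family_E"
  proof (rule family_E.extend[OF rest dist])
    show "disjnt {a, v, b} (verts ?K)"
      by (auto simp: vK disjnt_def)
    show "F \<subseteq> {{x, y} | x y. x \<in> {a, b} \<and> y \<in> verts ?K}"
      unfolding F_def by blast
    show "\<forall>C\<in>components ?K. card {e \<in> F. e \<inter> C \<noteq> {}} \<le> 1"
      using F1 by blast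
  qed
  moreover have "verts ?K \<union> {a, v, b} = verts G"
    using inG vK by blast
  moreover have "edges ?K \<union> {{a, v}, {v, b}} \<union> F = edges G"
  proof (intro equalityI subsetI)
    fix e assume "e \<in> edges ?K \<union> {{a, v}, {v, b}} \<union> F"
    then show "e \<in> edges G"
      using adj va unfolding F_def by (auto simp: induced_def adj_def)
  next
    fix e assume e: "e \<in> edges G"
    then obtain x y where xy: "e = {x, y}"
      using assms(1) by (auto simp: simple_graph_def card_2_iff)
    have a: "adj G x y" "adj G y x"
      using e xy by (auto simp: adj_def insert_commute)
    note V = simple_adj[OF assms(1) a(1)]
    consider "x = v" | "y = v" | "x \<in> {a, b}" "y \<in> {a, b}" | "x \<in> verts ?K" "y \<in> verts ?K"
      | "x \<in> {a, b}" "y \<in> verts ?K" | "y \<in> {a, b}" "x \<in> verts ?K"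
      using V vK by blast
    then show "e \<in> edges ?K \<union> {{a, v}, {v, b}} \<union> F"
    proof cases
      case 1
      then show ?thesis using deg[of y] a xy by (auto simp: insert_commute)
    next
      case 2
      then show ?thesis using deg[of x] a xy by (auto simp: insert_commute)
    next
      case 3
      then show ?thesis using no_ab a V by auto
    next
      case 4
      then show ?thesis using a xy adjK[of x y] by (auto simp: adj_def)
    next
      case 5
      then show ?thesis using a xy unfolding F_def by blast
    next
      case 6
      then show ?thesis using a xy unfolding F_def by (blast intro: insert_commute)
    qed
  qed
  ultimately show ?thesis
    by (metis graph.collapse)
qed

section \<open>A winning center has degree 2\<close>

text \<open>The sets closed under adjacency are the unions of components; an attached copy, being
  connected, lies inside such a set or outside it.\<close>

lemma family_E_closed_card:
  assumes "G \<in> family_E" "S \<subseteq> verts G" "\<And>x y. x \<in> S \<Longrightarrow> adj G x y \<Longrightarrow> y \<in> S"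
  shows "3 dvd card S"
  using assms
proof (induction arbitrary: S rule: family_E_attach_induct)
  case empty
  then show ?case by simp
next
  case (attach G a v b F)
  let ?G = "attach_P3 G a v b F"
  let ?A = "S \<inter> verts G" and ?B = "S \<inter> {a, v, b}"
  have "3 dvd card ?A"
  proof (rule attach.IH)
    fix x y assume x: "x \<in> ?A" and xy: "adj G x y"
    have "adj ?G x y"
      using xy by (simp add: adj_def attach_P3_def)
    then show "y \<in> ?A"
      using x xy attach.prems(2) simple_adj(2)[OF attach.hyps(1) xy] by blast
  qed simp
  moreover have "3 dvd card ?B"
  proof -
    have "adj ?G a v" "adj ?G v a" "adj ?G v b" "adj ?G b v"
      by (auto simp: adj_def attach_P3_def)
    then have "?B = {} \<or> ?B = {a, v, b}"
      using attach.prems(2) by blast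
    moreover have "card {a, v, b} = 3"
      using attach.hyps by simp
    ultimately show ?thesis by (metis card.empty dvd_0_right dvd_refl)
  qed
  moreover have "S = ?A \<union> ?B"
    using attach.prems(1) by (auto simp: attach_P3_def)
  moreover have "?A \<inter> ?B = {}"
    using attach.hyps by (auto simp: disjnt_def)
  moreover have "finite ?A" "finite ?B"
    using attach.hyps(1) by (auto simp: simple_graph_def)
  ultimately show ?case
    by (metis card_Un_disjoint dvd_add)
qed

text \<open>The set \<open>B x\<close> below is the branch at the neighbour \<open>x\<close> of \<open>v\<close>: the component of \<open>x\<close> in the
  graph without \<open>v\<close>. In a forest different neighbours lie in different branches, so the branch at
  one neighbour is a union of components of what remains when the other two neighbours are removed
  together with \<open>v\<close>.\<close>

lemma card_branches:
  assumes "simple_graph G" and forest: "\<nexists>vs. is_cycle G vs"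
    and dist: "distinct [a, b, c]" and nb: "adj G v a" "adj G v b" "adj G v c"
    and rest: "remove G (P3 a v b) \<in> family_E" "remove G (P3 a v c) \<in> family_E"
      "remove G (P3 b v c) \<in> family_E"
  shows "card (verts G) mod 3 = 1"
proof -
  let ?N = "adj (induced G (verts G - {v}))"
  define B where "B x = {y. ?N\<^sup>*\<^sup>* x y}" for x
  have N: "?N x y \<longleftrightarrow> adj G x y \<and> x \<noteq> v \<and> y \<noteq> v" for x y
    using simple_adj[OF assms(1)] unfolding adj_induced by blast
  have N_sym: "?N\<^sup>*\<^sup>* x y \<Longrightarrow> ?N\<^sup>*\<^sup>* y x" for x y
  proof -
    have "symp ?N"
      by (auto simp: symp_def adj_commute)
    then show "?N\<^sup>*\<^sup>* x y \<Longrightarrow> ?N\<^sup>*\<^sup>* y x"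
      by (auto dest: sympD[OF symp_rtranclp])
  qed
  have B_self: "x \<in> B x" for x
    by (simp add: B_def)
  have B_sub: "B x \<subseteq> verts G - {v}" if "adj G v x" for x
  proof
    fix y assume "y \<in> B x"
    then have "?N\<^sup>*\<^sup>* x y" by (simp add: B_def)
    then show "y \<in> verts G - {v}"
      by (cases rule: rtranclp.cases)
        (use simple_adj[OF assms(1) that] simple_adj[OF assms(1)] N in auto)
  qed
  have B_closed: "z \<in> B x" if "y \<in> B x" "adj G y z" "y \<noteq> v" "z \<noteq> v" for x y z
    using that N unfolding B_def by (auto intro: rtranclp.rtrancl_into_rtrancl)
  have B_sep: "y \<notin> B x" if x: "adj G v x" and y: "adj G v y" and "x \<noteq> y" for x y
  proof
    let ?R = "\<lambda>s t. adj G s t \<and> {s, t} \<noteq> {v, x}"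
    assume "y \<in> B x"
    then have "?N\<^sup>*\<^sup>* y x"
      using N_sym by (simp add: B_def)
    moreover have "?N s t \<Longrightarrow> ?R s t" for s t
      unfolding N by (auto simp: doubleton_eq_iff)
    ultimately have "?R\<^sup>*\<^sup>* y x"
      using mono_rtranclp[of ?N ?R] by blast
    moreover have "?R v y"
      using y \<open>x \<noteq> y\<close> by (auto simp: doubleton_eq_iff)
    ultimately have "?R\<^sup>*\<^sup>* v x"
      by (rule converse_rtranclp_into_rtranclp[rotated])
    then show False
      using forest_edge_bridge[OF forest x] simple_adj(3)[OF assms(1) x] by blast
  qed
  have B_disj: "B x \<inter> B y = {}" if "adj G v x" "adj G v y" "x \<noteq> y" for x y
  proof (rule ccontr)
    assume "B x \<inter> B y \<noteq> {}"
    then obtain z where "?N\<^sup>*\<^sup>* x z" "?N\<^sup>*\<^sup>* y z"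
      by (auto simp: B_def)
    then have "y \<in> B x"
      using N_sym[of y z] by (auto simp: B_def)
    then show False using B_sep that by blast
  qed
  have dvd: "3 dvd card S"
    if "remove G (P3 x v y) \<in> family_E" "S \<subseteq> verts G - {v}" "x \<notin> S" "y \<notin> S"
      and closed: "\<And>s t. s \<in> S \<Longrightarrow> adj G s t \<Longrightarrow> t \<noteq> v \<Longrightarrow> t \<in> S" for S x y
  proof (rule family_E_closed_card[OF that(1)])
    show "S \<subseteq> verts (remove G (P3 x v y))"
      using that(2-4) unfolding verts_remove by (auto simp: P3_def)
    fix s t assume "s \<in> S" "adj (remove G (P3 x v y)) s t"
    then show "t \<in> S"
      using closed[of s t] by (simp add: adj_induced P3_def)
  qed
  have B_dvd: "3 dvd card (B z)"
    if "remove G (P3 x v y) \<in> family_E" "adj G v x" "adj G v y" "adj G v z" "x \<noteq> z" "y \<noteq> z"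
    for x y z
  proof (rule dvd[OF that(1) B_sub[OF that(4)]])
    show "x \<notin> B z" "y \<notin> B z"
      using B_sep[of z x] B_sep[of z y] that by simp_all
    fix s t assume "s \<in> B z" "adj G s t" "t \<noteq> v"
    then show "t \<in> B z"
      using B_closed[of s z t] B_sub[OF that(4)] by auto
  qed
  let ?U = "B a \<union> B b \<union> B c"
  let ?O = "verts G - {v} - ?U"
  have "3 dvd card ?O"
  proof (rule dvd[OF rest(1)])
    fix s t assume s: "s \<in> ?O" and st: "adj G s t" and "t \<noteq> v"
    have "t \<notin> B x" if "s \<notin> B x" for x
      using that s B_closed[of t x s] st \<open>t \<noteq> v\<close> by (auto simp: adj_commute)
    then show "t \<in> ?O"
      using s simple_adj(2)[OF assms(1) st] \<open>t \<noteq> v\<close> by blast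
  qed (use B_self in auto)
  moreover have "3 dvd card ?U"
  proof -
    have "finite (B x)" if "adj G v x" for x
      using B_sub[OF that] assms(1) by (auto simp: simple_graph_def intro: finite_subset)
    then have "card ?U = card (B a) + card (B b) + card (B c)"
      using nb dist B_disj by (simp add: card_Un_disjoint Int_Un_distrib2)
    moreover have "3 dvd card (B a)" "3 dvd card (B b)" "3 dvd card (B c)"
      using nb dist rest by (auto intro: B_dvd)
    ultimately show ?thesis by simp
  qed
  moreover have "card (verts G) = Suc (card ?U + card ?O)"
  proof -
    have fin: "finite (verts G)"
      using assms(1) by (simp add: simple_graph_def)
    have U: "?U \<subseteq> verts G - {v}"
      using B_sub nb by blast
    have "card (verts G) = Suc (card (verts G - {v}))"
      using card_Suc_Diff1[OF fin simple_adj(1)[OF assms(1) nb(1)]] by simp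
    moreover have "card (verts G - {v}) = card ?U + card ?O"
    proof -
      have fin': "finite (verts G - {v})"
        using fin by blast
      have "card ?O = card (verts G - {v}) - card ?U"
        by (rule card_Diff_subset[OF finite_subset[OF U fin'] U])
      moreover have "card ?U \<le> card (verts G - {v})"
        by (rule card_mono[OF fin' U])
      ultimately show ?thesis by simp
    qed
    ultimately show ?thesis by simp
  qed
  ultimately show ?thesis by presburger
qed

lemma perfect_forest_family_E:
  assumes "simple_graph G" "\<nexists>vs. is_cycle G vs" "perfect Minimizer G"
  shows "G \<in> family_E"
  using assms
proof (induction "card (verts G)" arbitrary: G rule: less_induct)
  case less
  have fin: "finite (verts G)"
    using less.prems(1) by (simp add: simple_graph_def)
  show ?case
  proof (cases "centers G = {}")
    case True
    then have "verts G = {}"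
      using less.prems(3) fin by (simp add: perfect_iff star_value_no_center)
    moreover have "edges G = {}"
      using less.prems(1) calculation by (fastforce simp: simple_graph_def)
    ultimately have "G = Graph {} {}"
      by (simp add: graph.expand)
    then show ?thesis
      using family_E.start[of "{}"] by simp
  next
    case False
    obtain v where v: "v \<in> centers G"
      and good: "\<And>H. H \<in> P3_copies G v \<Longrightarrow> perfect Minimizer (remove G H)"
      using less.prems(3) perfect_iff_center[OF fin False] by blast
    have copy: "P3 x v y \<in> P3_copies G v" if "adj G v x" "adj G v y" "x \<noteq> y" for x y
      using that simple_adj[OF less.prems(1) that(1)] simple_adj[OF less.prems(1) that(2)]
      unfolding P3_copies_iff
      by (intro exI[of _ x] exI[of _ y]) auto
    have rest: "remove G (P3 x v y) \<in> family_E" if "adj G v x" "adj G v y" "x \<noteq> y" for x y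
    proof (rule less.hyps)
      show "card (verts (remove G (P3 x v y))) < card (verts G)"
        using card_remove_P3[OF fin copy[OF that]] by simp
    qed (use less.prems good copy[OF that] simple_induced forest_induced in blast)+
    obtain H where "H \<in> P3_copies G v"
      using v by (auto simp: centers_def)
    then obtain a b where ab: "distinct [a, v, b]" "adj G v a" "adj G v b"
      unfolding P3_copies_iff by blast
    have "c = a \<or> c = b" if c: "adj G v c" for c
    proof (rule ccontr)
      assume "\<not> (c = a \<or> c = b)"
      then have "card (verts G) mod 3 = 1"
        using less.prems ab c by (intro card_branches[of G a b c v] rest) auto
      moreover have "card (verts G) mod 3 = 0"
        using less.prems(3) unfolding perfect_iff by presburger
      ultimately show False by simp
    qed
    then show ?thesis
      using family_E_attach[OF less.prems(1,2) ab] rest ab by auto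
  qed
qed

theorem lemma10:
  fixes T :: "'a graph"
  assumes "tree T"
  shows "perfect Minimizer T \<longleftrightarrow> T \<in> family_E"
  using assms perfect_forest_family_E family_E_perfect unfolding tree_def by blast

end
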